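(* Let $(\Sigma,I)$ be a trace alphabet, let $\varphi$ be a formula of $\mathrm{LTL}(\Sigma,I)$, let $\mathcal A^{\varphi}$ and $\mathcal A^{\neg\varphi}$ be nondeterministic Büchi automata over $\Sigma$ with $\mathcal L(\mathcal A^{\varphi})=\{w\in\Sigma^\omega\mid T_w\models\varphi\}$ and $\mathcal L(\mathcal A^{\neg\varphi})=\{w\in\Sigma^\omega\mid T_w\models\neg\varphi\}$, and let $\mathcal B^{\varphi}=(\Sigma,\bar Q,\bar q_0,\bar\delta,\bar\lambda)$ be the corresponding monitor (the Moore machine constructed from $\mathcal A^{\varphi}$ and $\mathcal A^{\neg\varphi}$ as described in the context). Then for all $u\in\Sigma^\ast$, $$[u\models^{t}\varphi]=\bar\lambda(\bar\delta(\bar q_0,u)).$$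
   Context: **Trace alphabet.** A trace alphabet is a pair $(\Sigma,I)$ where $\Sigma$ is a finite non-empty set and $I\subseteq\Sigma\times\Sigma$ is irreflexive and symmetric (independence). Put $D=(\Sigma\times\Sigma)\setminus I$ (dependency). $\Sigma^\infty=\Sigma^\ast\cup\Sigma^\omega$ is the set of finite and infinite words. **Traces.** A trace over $(\Sigma,I)$ is a $\Sigma$-labelled poset $T=(E,\leq,\lambda)$, $\lambda:E\to\Sigma$, such that: (i) ${\downarrow}e=\{x\in E\mid x\le e\}$ is finite for every $e\in E$; (ii) if $e'$ covers $e$ (i.e. $e<e'$ and nothing lies strictly between), then $(\lambda(e),\lambda(e'))\in D$; (iii) if $(\lambda(e),\lambda(e'))\in D$ then $e\le e'$ or $e'\le e$. Isomorphic traces are identified. **Configurations.** A configuration of $T$ is a finite set $c\subseteq E$ that is downward closed. $\mathcal C_T$ is the set of configurations. For $c,c'\in\mathcal C_T$ and $a\in\Sigma$, $c\xrightarrow{a}_T c'$ means there is $e\in E\setminus c$ with $\lambda(e)=a$ and $c'=c\cup\{e\}$. **Linearisations.** $w\in\Sigma^\infty$ is a linearisation of $T$ iff there is a map $\rho$ from the finite prefixes of $w$ to $\mathcal C_T$ with $\rho(\varepsilon)=\emptyset$, $\rho(v)\xrightarrow{a}_T\rho(va)$ for each finite prefix $va$ of $w$, and every $e\in E$ belongs to $\rho(u)$ for some finite prefix $u$ of $w$. For $w\in\Sigma^\infty$, $T_w$ is the unique (up to isomorphism) trace having $w$ as a linearisation. (Concretely: events are the positions of $w$, labelled by their letters, and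 $\le$ is the reflexive-transitive closure of $\{(i,j)\mid i<j,\ (w_i,w_j)\in D\}$.) **Logic.** Formulas of $\mathrm{LTL}(\Sigma,I)$ (also called LTrL) are given by $\varphi::=\mathrm{tt}\mid\neg\varphi\mid\varphi\vee\psi\mid\langle a\rangle\varphi\mid\varphi\,\mathcal U\,\psi$ with $a\in\Sigma$. For a trace $T$ and $c\in\mathcal C_T$: $T,c\models\mathrm{tt}$ always; $\neg,\vee$ are interpreted as usual; $T,c\models\langle a\rangle\varphi$ iff there is $c'\in\mathcal C_T$ with $c\xrightarrow{a}_T c'$ and $T,c'\models\varphi$; $T,c\models\varphi\,\mathcal U\,\psi$ iff there is $c'\in\mathcal C_T$ with $c\subseteq c'$, $T,c'\models\psi$, and $T,c''\models\varphi$ for all $c''\in\mathcal C_T$ with $c\subseteq c''\subsetneq c'$. $T\models\varphi$ means $T,\emptyset\models\varphi$. **Three-valued semantics.** For $u\in\Sigma^\ast$, the value $[u\models^{t}\varphi]\in\{\bot,?,\top\}$ is $\top$ if $T_{u\sigma}\models\varphi$ for all $\sigma\in\Sigma^\omega$; $\bot$ if $T_{u\sigma}\not\models\varphi$ for all $\sigma\in\Sigma^\omega$; and $?$ otherwise. **Automata.** A nondeterministic Büchi automaton (NBA) is $\mathcal A=(\Sigma,Q,Q_0,\delta,F)$ with $Q$ finite non-empty, $Q_0\subseteq Q$ the initial states, $\delta:Q\times\Sigma\to 2^Q$, and $F\subseteq Q$; it accepts $w\in\Sigma^\omega$ iff it has a run on $w$ starting in $Q_0$ and visiting $F$ infinitely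 often. $\mathcal A(q)$ is $\mathcal A$ with initial state set replaced by $\{q\}$. NFAs have the same components and accept finite words by ending in $F$. **Monitor construction.** Write $\mathcal A^{\psi}=(\Sigma,Q^\psi,Q_0^\psi,\delta^\psi,F^\psi)$ for $\psi\in\{\varphi,\neg\varphi\}$. Let $\hat{\mathcal A}^{\psi}=(\Sigma,Q^\psi,Q_0^\psi,\delta^\psi,\hat F^\psi)$ be the NFA with $\hat F^\psi=\{q\in Q^\psi\mid\mathcal L(\mathcal A^\psi(q))\neq\emptyset\}$. Let $\tilde{\mathcal A}^{\psi}$ be the complete DFA obtained from $\hat{\mathcal A}^\psi$ by the power-set construction, with initial state $q_0^\psi$, transition function again written $\delta^\psi$, and accepting states $\tilde F^\psi$. The monitor $\mathcal B^\varphi$ is the minimized version (unreachable states removed, equivalent states merged) of the Moore machine whose states are pairs $(q,q')$ of a state of $\tilde{\mathcal A}^\varphi$ and a state of $\tilde{\mathcal A}^{\neg\varphi}$, with initial state $(q_0^\varphi,q_0^{\neg\varphi})$, transitions $((q,q'),a)\mapsto(\delta^\varphi(q,a),\delta^{\neg\varphi}(q',a))$, and output at $(q,q')$ equal to $\top$ if $q'\notin\tilde F^{\neg\varphi}$, $\bot$ if $q\notin\tilde F^{\varphi}$, and $?$ if $q\in\tilde F^\varphi$ and $q'\in\tilde F^{\neg\varphi}$ (cases read in this order should the first two overlap). The components of the resulting Moore machine are $\bar Q,\bar q_0,\bar\delta,\bar\lambda$, with $\bar\delta$ extended to finite words as usual. *)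

theory Defs
  imports Main "HOL-Library.Omega_Words_Fun"
begin

text \<open>
  The alphabet is the type \<open>'a\<close>; its finiteness is the sort constraint in the theorem
  (HOL types are never empty).
\<close>

definition trace_alphabet :: "'a rel \<Rightarrow> bool" where
  "trace_alphabet I \<longleftrightarrow> irrefl I \<and> sym I"

abbreviation dep :: "'a rel \<Rightarrow> 'a rel" where
  "dep I \<equiv> UNIV \<times> UNIV - I"


section \<open>Traces and configurations\<close>

record ('e, 'a) ltrace =
  events :: "'e set"
  tle :: "'e rel"
  label :: "'e \<Rightarrow> 'a"

definition covers :: "('e, 'a) ltrace \<Rightarrow> 'e \<Rightarrow> 'e \<Rightarrow> bool" where
  "covers T e e' \<longleftrightarrow> (e, e') \<in> tle T \<and> e \<noteq> e' \<and>
     \<not> (\<exists>x. (e, x) \<in> tle T \<and> x \<noteq> e \<and> (x, e') \<in> tle T \<and> x \<noteq> e')"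

definition is_trace :: "'a rel \<Rightarrow> ('e, 'a) ltrace \<Rightarrow> bool" where
  "is_trace I T \<longleftrightarrow>
     partial_order_on (events T) (tle T) \<and>
     (\<forall>e\<in>events T. finite {x \<in> events T. (x, e) \<in> tle T}) \<and>
     (\<forall>e\<in>events T. \<forall>e'\<in>events T. covers T e e' \<longrightarrow> (label T e, label T e') \<in> dep I) \<and>
     (\<forall>e\<in>events T. \<forall>e'\<in>events T. (label T e, label T e') \<in> dep I \<longrightarrow>
        (e, e') \<in> tle T \<or> (e', e) \<in> tle T)"

definition configs :: "('e, 'a) ltrace \<Rightarrow> 'e set set" where
  "configs T = {c. finite c \<and> c \<subseteq> events T \<and> (\<forall>e\<in>c. \<forall>x\<in>events T. (x, e) \<in> tle T \<longrightarrow> x \<in> c)}"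

definition step :: "('e, 'a) ltrace \<Rightarrow> 'e set \<Rightarrow> 'a \<Rightarrow> 'e set \<Rightarrow> bool" where
  "step T c a c' \<longleftrightarrow> c \<in> configs T \<and> c' \<in> configs T \<and>
     (\<exists>e \<in> events T - c. label T e = a \<and> c' = c \<union> {e})"

text \<open>
  Only infinite words are needed. A finite prefix of \<open>w\<close> is identified with its length \<open>n\<close>.
\<close>

definition linearisation :: "'a word \<Rightarrow> ('e, 'a) ltrace \<Rightarrow> bool" where
  "linearisation w T \<longleftrightarrow> (\<exists>\<rho> :: nat \<Rightarrow> 'e set.
     (\<forall>n. \<rho> n \<in> configs T) \<and> \<rho> 0 = {} \<and> (\<forall>n. step T (\<rho> n) (w n) (\<rho> (Suc n))) \<and>
     (\<forall>e\<in>events T. \<exists>n. e \<in> \<rho> n))"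

text \<open>
  \<open>trace_of I w\<close> is the trace with linearisation \<open>w\<close>: see \<open>is_trace_trace_of\<close>,
  \<open>linearisation_trace_of\<close> and, for uniqueness up to isomorphism,
  \<open>trace_of_unique\<close> below.
\<close>

definition trace_of :: "'a rel \<Rightarrow> 'a word \<Rightarrow> (nat, 'a) ltrace" where
  "trace_of I w = \<lparr>events = UNIV, tle = {(i, j). i < j \<and> (w i, w j) \<in> dep I}\<^sup>*, label = w\<rparr>"

definition trace_iso :: "('e \<Rightarrow> 'f) \<Rightarrow> ('e, 'a) ltrace \<Rightarrow> ('f, 'a) ltrace \<Rightarrow> bool" where
  "trace_iso h S T \<longleftrightarrow> bij_betw h (events S) (events T) \<and>
     (\<forall>x\<in>events S. label T (h x) = label S x) \<and>
     (\<forall>x\<in>events S. \<forall>y\<in>events S. (x, y) \<in> tle S \<longleftrightarrow> (h x, h y) \<in> tle T)"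

lemma word_dep_le:
  assumes "(i, j) \<in> {(i, j). i < j \<and> (w i, w j) \<in> dep I}\<^sup>*"
  shows "i \<le> (j :: nat)"
  using assms by (induction rule: rtrancl_induct) auto

lemma configs_trace_of: "{..<n} \<in> configs (trace_of I w)"
proof -
  have "x < n" if "e < n" "(x, e) \<in> tle (trace_of I w)" for x e
    using that word_dep_le[of x e w I] by (simp add: trace_of_def)
  then show ?thesis by (auto simp: configs_def) (simp add: trace_of_def)
qed

lemma linearisation_trace_of: "linearisation w (trace_of I w)"
  unfolding linearisation_def
proof (intro exI[of _ "\<lambda>n. {..<n}"] conjI allI ballI)
  fix n show "step (trace_of I w) {..<n} (w n) {..<Suc n}"
    unfolding step_def
    by (intro conjI configs_trace_of bexI[of _ n]) (auto simp: trace_of_def)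
qed (auto simp: configs_trace_of)

lemma is_trace_trace_of:
  assumes "trace_alphabet I"
  shows "is_trace I (trace_of I w)"
proof -
  define R where "R = {(i, j). i < j \<and> (w i, w j) \<in> dep I}"
  have le: "i \<le> j" if "(i, j) \<in> R\<^sup>*" for i j
    using word_dep_le that unfolding R_def by blast
  have T: "events (trace_of I w) = UNIV" "tle (trace_of I w) = R\<^sup>*" "label (trace_of I w) = w"
    by (auto simp: trace_of_def R_def)
  have po: "partial_order_on UNIV (R\<^sup>*)"
    unfolding partial_order_on_def preorder_on_def
  proof (intro conjI)
    show "antisym (R\<^sup>*)" by (rule antisymI) (meson le le_antisym)
  qed (simp_all add: refl_on_def trans_rtrancl)
  have fin: "finite {x. (x, e) \<in> R\<^sup>*}" for e
    by (rule finite_subset[of _ "{..e}"]) (auto dest: le)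
  have cov: "(w e, w e') \<in> dep I" if "covers (trace_of I w) e e'" for e e'
  proof -
    have "(e, e') \<in> R\<^sup>*" "e \<noteq> e'" using that by (auto simp: covers_def T)
    then obtain x where x: "(e, x) \<in> R\<^sup>*" "(x, e') \<in> R" by (metis rtranclE)
    then have "x \<noteq> e'" "(x, e') \<in> R\<^sup>*" by (auto simp: R_def)
    with x that have "x = e" by (auto simp: covers_def T)
    with x show ?thesis by (simp add: R_def)
  qed
  have tot: "(e, e') \<in> R\<^sup>* \<or> (e', e) \<in> R\<^sup>*" if "(w e, w e') \<in> dep I" for e e'
  proof -
    have "(w e', w e) \<in> dep I" using that assms by (auto simp: trace_alphabet_def dest: symD)
    with that have "e = e' \<or> (e, e') \<in> R \<or> (e', e) \<in> R"
      by (auto simp: R_def)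
    then show ?thesis by auto
  qed
  show ?thesis unfolding is_trace_def T using po fin cov tot by simp
qed

lemma trace_of_unique:
  fixes T :: "('e, 'a) ltrace"
  assumes I: "trace_alphabet I" and T: "is_trace I T" and lin: "linearisation w T"
  shows "\<exists>h. trace_iso h (trace_of I w) T"
proof -
  define R where "R = {(i, j). i < j \<and> (w i, w j) \<in> dep I}"
  obtain \<rho> where c: "\<And>n. \<rho> n \<in> configs T" and r0: "\<rho> 0 = {}"
    and st: "\<And>n. step T (\<rho> n) (w n) (\<rho> (Suc n))" and all: "\<And>e. e \<in> events T \<Longrightarrow> \<exists>n. e \<in> \<rho> n"
    using lin unfolding linearisation_def by blast
  have "\<forall>n. \<exists>e. e \<in> events T - \<rho> n \<and> label T e = w n \<and> \<rho> (Suc n) = \<rho> n \<union> {e}"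
    using st unfolding step_def by blast
  then obtain h where h: "\<And>n. h n \<in> events T" "\<And>n. h n \<notin> \<rho> n" "\<And>n. label T (h n) = w n"
    "\<And>n. \<rho> (Suc n) = \<rho> n \<union> {h n}" by (metis DiffD1 DiffD2)
  have \<rho>: "\<rho> n = h ` {..<n}" for n
    by (induction n) (auto simp: r0 h lessThan_Suc)
  have inj: "inj h"
  proof (rule linorder_injI)
    fix i j :: nat assume "i < j"
    then have "h i \<in> \<rho> j" by (auto simp: \<rho>)
    with h(2)[of j] show "h i \<noteq> h j" by auto
  qed
  have surj: "events T = range h"
    using h(1) all by (fastforce simp: \<rho>)
  have idx: "i \<le> j" if "(h i, h j) \<in> tle T" for i j
  proof -
    have "h j \<in> \<rho> (Suc j)" by (auto simp: \<rho>)
    with c[of "Suc j"] that h(1) have "h i \<in> \<rho> (Suc j)" by (auto simp: configs_def)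
    then show ?thesis using inj by (auto simp: \<rho> inj_eq)
  qed
  have tr: "trans (tle T)" and rf: "\<And>e. e \<in> events T \<Longrightarrow> (e, e) \<in> tle T"
    and sub: "tle T \<subseteq> events T \<times> events T"
    using T unfolding is_trace_def partial_order_on_def preorder_on_def refl_on_def by blast+
  have cov: "(label T e, label T e') \<in> dep I"
    if "e \<in> events T" "e' \<in> events T" "covers T e e'" for e e'
    using T that unfolding is_trace_def by blast
  have tot: "(e, e') \<in> tle T \<or> (e', e) \<in> tle T"
    if "e \<in> events T" "e' \<in> events T" "(label T e, label T e') \<in> dep I" for e e'
    using T that unfolding is_trace_def by blast
  have 1: "(h i, h j) \<in> tle T" if "(i, j) \<in> R\<^sup>*" for i j
    using that
  proof (induction rule: rtrancl_induct)
    case base show ?case by (rule rf[OF h(1)])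
  next
    case (step j k)
    then have "j < k" "(w j, w k) \<in> dep I" by (auto simp: R_def)
    then have "(h j, h k) \<in> tle T \<or> (h k, h j) \<in> tle T"
      using tot[of "h j" "h k"] h(1,3) by simp
    with idx[of k j] \<open>j < k\<close> have "(h j, h k) \<in> tle T" by auto
    with step.IH tr show ?case by (meson transD)
  qed
  have 2: "(i, j) \<in> R\<^sup>*" if "(h i, h j) \<in> tle T" for i j
    using that
  proof (induction j rule: less_induct)
    case (less j)
    show ?case
    proof (cases "i = j")
      case False
      with idx less.prems have "i < j" by (metis nat_less_le)
      define M where "M = {k. k < j \<and> (h i, h k) \<in> tle T \<and> (h k, h j) \<in> tle T}"
      have "finite M" "i \<in> M" using \<open>i < j\<close> less.prems rf[OF h(1)] by (auto simp: M_def)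
      define k where "k = Max M"
      have kM: "k \<in> M" unfolding k_def using \<open>finite M\<close> \<open>i \<in> M\<close> by (auto intro: Max_in)
      have kmax: "m \<le> k" if "m \<in> M" for m unfolding k_def using \<open>finite M\<close> that by auto
      have "covers T (h k) (h j)"
        unfolding covers_def
      proof (intro conjI notI)
        show "(h k, h j) \<in> tle T" using kM by (auto simp: M_def)
        show False if "h k = h j" using that kM inj by (auto simp: M_def inj_eq)
        assume "\<exists>x. (h k, x) \<in> tle T \<and> x \<noteq> h k \<and> (x, h j) \<in> tle T \<and> x \<noteq> h j"
        then obtain x where x: "(h k, x) \<in> tle T" "x \<noteq> h k" "(x, h j) \<in> tle T" "x \<noteq> h j"
          by blast
        then obtain m where m: "x = h m" using sub surj by auto
        from x m idx have "k \<le> m" "k \<noteq> m" "m \<le> j" "m \<noteq> j" by auto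
        moreover have "(h i, h m) \<in> tle T" using kM x m transD[OF tr, of "h i" "h k" "h m"] by (simp add: M_def)
        ultimately have "m \<in> M" using x m by (auto simp: M_def)
        with kmax \<open>k \<le> m\<close> \<open>k \<noteq> m\<close> show False by fastforce
      qed
      then have "(w k, w j) \<in> dep I" using cov[of "h k" "h j"] h(1,3) by simp
      then have "(k, j) \<in> R" using kM by (auto simp: R_def M_def)
      moreover have "(i, k) \<in> R\<^sup>*" using less.IH kM by (auto simp: M_def)
      ultimately show ?thesis by (rule rtrancl_into_rtrancl[rotated])
    qed simp
  qed
  have "trace_iso h (trace_of I w) T"
    using 1 2 inj surj h(3)
    by (auto simp: trace_iso_def trace_of_def R_def bij_betw_def)
  then show ?thesis by blast
qed


section \<open>The logic\<close>

datatype 'a ltrl =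
    TT
  | Neg "'a ltrl"
  | Or "'a ltrl" "'a ltrl"
  | Dia 'a "'a ltrl"
  | Until "'a ltrl" "'a ltrl"

primrec sat :: "('e, 'a) ltrace \<Rightarrow> 'e set \<Rightarrow> 'a ltrl \<Rightarrow> bool" where
  "sat T c TT \<longleftrightarrow> True"
| "sat T c (Neg \<phi>) \<longleftrightarrow> \<not> sat T c \<phi>"
| "sat T c (Or \<phi> \<psi>) \<longleftrightarrow> sat T c \<phi> \<or> sat T c \<psi>"
| "sat T c (Dia a \<phi>) \<longleftrightarrow> (\<exists>c'\<in>configs T. step T c a c' \<and> sat T c' \<phi>)"
| "sat T c (Until \<phi> \<psi>) \<longleftrightarrow> (\<exists>c'\<in>configs T. c \<subseteq> c' \<and> sat T c' \<psi> \<and>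
     (\<forall>c''\<in>configs T. c \<subseteq> c'' \<and> c'' \<subset> c' \<longrightarrow> sat T c'' \<phi>))"

definition models :: "('e, 'a) ltrace \<Rightarrow> 'a ltrl \<Rightarrow> bool" where
  "models T \<phi> \<longleftrightarrow> sat T {} \<phi>"

datatype verdict = Bot | Unknown | Top

definition verdict_of :: "'a rel \<Rightarrow> 'a list \<Rightarrow> 'a ltrl \<Rightarrow> verdict" where
  "verdict_of I u \<phi> =
     (if \<forall>\<sigma> :: 'a word. models (trace_of I (u \<frown> \<sigma>)) \<phi> then Top
      else if \<forall>\<sigma> :: 'a word. \<not> models (trace_of I (u \<frown> \<sigma>)) \<phi> then Bot
      else Unknown)"


section \<open>Automata\<close>

record ('q, 'a) nondet_aut =
  nstates :: "'q set"
  ninit :: "'q set"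
  ntrans :: "'q \<Rightarrow> 'a \<Rightarrow> 'q set"
  nfinal :: "'q set"

definition nondet_automaton :: "('q, 'a) nondet_aut \<Rightarrow> bool" where
  "nondet_automaton A \<longleftrightarrow> finite (nstates A) \<and> nstates A \<noteq> {} \<and> ninit A \<subseteq> nstates A \<and>
     (\<forall>q\<in>nstates A. \<forall>a. ntrans A q a \<subseteq> nstates A) \<and> nfinal A \<subseteq> nstates A"

definition is_run :: "('q, 'a) nondet_aut \<Rightarrow> 'a word \<Rightarrow> (nat \<Rightarrow> 'q) \<Rightarrow> bool" where
  "is_run A w r \<longleftrightarrow> r 0 \<in> ninit A \<and> (\<forall>n. r (Suc n) \<in> ntrans A (r n) (w n))"

definition nba_lang :: "('q, 'a) nondet_aut \<Rightarrow> 'a word set" where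
  "nba_lang A = {w. \<exists>r. is_run A w r \<and> (\<exists>\<^sub>\<infinity>n. r n \<in> nfinal A)}"

definition start_from :: "('q, 'a) nondet_aut \<Rightarrow> 'q \<Rightarrow> ('q, 'a) nondet_aut" where
  "start_from A q = A\<lparr>ninit := {q}\<rparr>"

record ('q, 'a) det_aut =
  dstates :: "'q set"
  dinit :: "'q"
  dtrans :: "'q \<Rightarrow> 'a \<Rightarrow> 'q"
  dfinal :: "'q set"

record ('q, 'a, 'o) moore =
  mstates :: "'q set"
  minit :: "'q"
  mtrans :: "'q \<Rightarrow> 'a \<Rightarrow> 'q"
  mout :: "'q \<Rightarrow> 'o"

definition mtrans_ext :: "('q, 'a, 'o) moore \<Rightarrow> 'q \<Rightarrow> 'a list \<Rightarrow> 'q" where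
  "mtrans_ext M q u = foldl (mtrans M) q u"


section \<open>Monitor construction\<close>

definition nonempty_nfa :: "('q, 'a) nondet_aut \<Rightarrow> ('q, 'a) nondet_aut" where
  "nonempty_nfa A = A\<lparr>nfinal := {q \<in> nstates A. nba_lang (start_from A q) \<noteq> {}}\<rparr>"

definition powerset_dfa :: "('q, 'a) nondet_aut \<Rightarrow> ('q set, 'a) det_aut" where
  "powerset_dfa A =
     \<lparr>dstates = Pow (nstates A),
      dinit = ninit A,
      dtrans = (\<lambda>S a. \<Union>q\<in>S. ntrans A q a),
      dfinal = {S \<in> Pow (nstates A). S \<inter> nfinal A \<noteq> {}}\<rparr>"

definition product_moore ::
    "('p, 'a) det_aut \<Rightarrow> ('q, 'a) det_aut \<Rightarrow> ('p \<times> 'q, 'a, verdict) moore" where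
  "product_moore D D' =
     \<lparr>mstates = dstates D \<times> dstates D',
      minit = (dinit D, dinit D'),
      mtrans = (\<lambda>(q, q') a. (dtrans D q a, dtrans D' q' a)),
      mout = (\<lambda>(q, q'). if q' \<notin> dfinal D' then Top
                         else if q \<notin> dfinal D then Bot
                         else Unknown)\<rparr>"

definition reachable :: "('q, 'a, 'o) moore \<Rightarrow> 'q set" where
  "reachable M = {mtrans_ext M (minit M) u | u. True}"

definition moore_equiv :: "('q, 'a, 'o) moore \<Rightarrow> 'q rel" where
  "moore_equiv M = {(p, q). p \<in> reachable M \<and> q \<in> reachable M \<and>
     (\<forall>v. mout M (mtrans_ext M p v) = mout M (mtrans_ext M q v))}"

text \<open>
  The image sets under \<open>the_elem\<close> are singletons on equivalence classes, because
  transitions and outputs respect \<open>moore_equiv\<close>.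
\<close>

definition minimize :: "('q, 'a, 'o) moore \<Rightarrow> ('q set, 'a, 'o) moore" where
  "minimize M =
     \<lparr>mstates = reachable M // moore_equiv M,
      minit = moore_equiv M `` {minit M},
      mtrans = (\<lambda>C a. the_elem ((\<lambda>q. moore_equiv M `` {mtrans M q a}) ` C)),
      mout = (\<lambda>C. the_elem (mout M ` C))\<rparr>"

definition monitor ::
    "('p, 'a) nondet_aut \<Rightarrow> ('q, 'a) nondet_aut \<Rightarrow> (('p set \<times> 'q set) set, 'a, verdict) moore"
  where
  "monitor A A' = minimize (product_moore (powerset_dfa (nonempty_nfa A))
                                          (powerset_dfa (nonempty_nfa A')))"

end

theory Submission
  imports Defs
begin

text \<open>
  The verdict on \<open>u\<close> depends only on whether \<open>u\<close> can be extended to an infinite word in each of the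
  two languages. An extension exists iff some run on \<open>u\<close> ends in a state of nonempty language, which
  is what the power-set automaton records; minimization preserves outputs.
\<close>

lemma Inf_many_Suc_iff: "(\<exists>\<^sub>\<infinity>n. P (Suc n)) \<longleftrightarrow> (\<exists>\<^sub>\<infinity>n. P n)"
  using eventually_sequentially_Suc[of "\<lambda>n. \<not> P n"]
  by (simp add: cofinite_eq_sequentially frequently_def)

text \<open>Runs on \<open>w\<close> and on its tail correspond by deleting or prepending one state,
  which does not affect visiting \<open>nfinal A\<close> infinitely often. An arbitrary initial set
  \<open>S\<close> is allowed so that reading one letter becomes one step of the subset
  construction.\<close>

lemma nba_lang_shift:
  "w \<in> nba_lang (A\<lparr>ninit := S\<rparr>) \<longleftrightarrow>
   suffix 1 w \<in> nba_lang (A\<lparr>ninit := \<Union>q\<in>S. ntrans A q (w 0)\<rparr>)"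
proof
  assume "w \<in> nba_lang (A\<lparr>ninit := S\<rparr>)"
  then obtain r where r: "r 0 \<in> S" "\<And>n. r (Suc n) \<in> ntrans A (r n) (w n)"
    and inf: "\<exists>\<^sub>\<infinity>n. r n \<in> nfinal A"
    by (auto simp: nba_lang_def is_run_def)
  have "\<exists>\<^sub>\<infinity>n. r (Suc n) \<in> nfinal A"
    using inf by (simp add: Inf_many_Suc_iff[of "\<lambda>n. r n \<in> nfinal A"])
  with r show "suffix 1 w \<in> nba_lang (A\<lparr>ninit := \<Union>q\<in>S. ntrans A q (w 0)\<rparr>)"
    by (auto simp: nba_lang_def is_run_def suffix_def intro!: exI[of _ "\<lambda>n. r (Suc n)"])
next
  assume "suffix 1 w \<in> nba_lang (A\<lparr>ninit := \<Union>q\<in>S. ntrans A q (w 0)\<rparr>)"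
  then obtain r q where q: "q \<in> S" "r 0 \<in> ntrans A q (w 0)"
    and r: "\<And>n. r (Suc n) \<in> ntrans A (r n) (w (Suc n))"
    and inf: "\<exists>\<^sub>\<infinity>n. r n \<in> nfinal A"
    by (auto simp: nba_lang_def is_run_def suffix_def)
  \<comment> \<open>The run \<open>r\<close> is prolonged backwards by its predecessor
    \<open>q\<close> in \<open>S\<close>.\<close>
  define r' where "r' = case_nat q r"
  have "\<exists>\<^sub>\<infinity>n. r' (Suc n) \<in> nfinal A"
    using inf by (simp add: r'_def)
  then have "\<exists>\<^sub>\<infinity>n. r' n \<in> nfinal A"
    by (simp add: Inf_many_Suc_iff[of "\<lambda>n. r' n \<in> nfinal A"])
  moreover have "r' (Suc n) \<in> ntrans A (r' n) (w n)" for n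
    using q r by (cases n) (auto simp: r'_def)
  moreover have "r' 0 \<in> S" using q by (simp add: r'_def)
  ultimately show "w \<in> nba_lang (A\<lparr>ninit := S\<rparr>)"
    by (auto simp: nba_lang_def is_run_def)
qed

text \<open>Iterates \<open>nba_lang_shift\<close> along \<open>u\<close>; the fold is exactly how
  the power-set automaton reads \<open>u\<close>.\<close>

lemma conc_in_nba_lang_iff:
  "u \<frown> w \<in> nba_lang (A\<lparr>ninit := S\<rparr>) \<longleftrightarrow>
   w \<in> nba_lang (A\<lparr>ninit := foldl (\<lambda>S a. \<Union>q\<in>S. ntrans A q a) S u\<rparr>)"
proof (induction u arbitrary: S)
  case (Cons a u)
  have "suffix 1 ((a # u) \<frown> w) = u \<frown> w" "((a # u) \<frown> w) 0 = a"
    by (auto simp: fun_eq_iff suffix_def conc_def)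
  with Cons show ?case by (subst nba_lang_shift) simp
qed simp

lemma nba_lang_init_Union:
  "nba_lang (A\<lparr>ninit := S\<rparr>) = (\<Union>q\<in>S. nba_lang (start_from A q))"
  by (auto simp: nba_lang_def is_run_def start_from_def)

text \<open>Accepting sets of the power-set automaton are by definition subsets of
  \<open>nstates A\<close>, so membership in \<open>dfinal\<close> also demands this
  closure.\<close>

lemma foldl_trans_closed:
  assumes "nondet_automaton A" "S \<subseteq> nstates A"
  shows "foldl (\<lambda>S a. \<Union>q\<in>S. ntrans A q a) S u \<subseteq> nstates A"
  using assms(2)
proof (induction u arbitrary: S)
  case (Cons a u)
  have "(\<Union>q\<in>S. ntrans A q a) \<subseteq> nstates A"
    using Cons.prems assms(1) by (fastforce simp: nondet_automaton_def)
  from Cons.IH[OF this] show ?case by simp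
qed simp

text \<open>A set is accepting when it contains a state with some accepted continuation \<sigma>.
  Exchanging the existential quantifiers over state and \<sigma> turns this into an accepted
  extension of \<open>u\<close>.\<close>

lemma extension_iff_dfa_accepts:
  assumes "nondet_automaton A"
  defines "D \<equiv> powerset_dfa (nonempty_nfa A)"
  shows "foldl (dtrans D) (dinit D) u \<in> dfinal D \<longleftrightarrow> (\<exists>\<sigma>. u \<frown> \<sigma> \<in> nba_lang A)"
proof -
  define R where "R = foldl (\<lambda>S a. \<Union>q\<in>S. ntrans A q a) (ninit A) u"
  have "R \<subseteq> nstates A"
    using foldl_trans_closed[OF assms(1)] assms(1) by (simp add: R_def nondet_automaton_def)
  moreover have "foldl (dtrans D) (dinit D) u = R"
    by (simp add: D_def powerset_dfa_def nonempty_nfa_def R_def)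
  moreover have "dfinal D = {S. S \<subseteq> nstates A \<and> (\<exists>q\<in>S. nba_lang (start_from A q) \<noteq> {})}"
    by (auto simp: D_def powerset_dfa_def nonempty_nfa_def)
  moreover have "u \<frown> \<sigma> \<in> nba_lang A \<longleftrightarrow> (\<exists>q\<in>R. \<sigma> \<in> nba_lang (start_from A q))" for \<sigma>
    using conc_in_nba_lang_iff[where A = A and S = "ninit A"] by (simp add: nba_lang_init_Union R_def)
  ultimately show ?thesis by auto
qed

lemma mtrans_ext_simps [simp]:
  "mtrans_ext M q [] = q"
  "mtrans_ext M q (a # u) = mtrans_ext M (mtrans M q a) u"
  by (simp_all add: mtrans_ext_def)

lemma init_reachable: "minit M \<in> reachable M"
  unfolding reachable_def by (auto intro: exI[of _ "[]"])

lemma reachable_step: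
  assumes "q \<in> reachable M"
  shows "mtrans M q a \<in> reachable M"
proof -
  obtain u where "q = mtrans_ext M (minit M) u" using assms by (auto simp: reachable_def)
  then have "mtrans M q a = mtrans_ext M (minit M) (u @ [a])" by (simp add: mtrans_ext_def)
  then show ?thesis by (auto simp: reachable_def)
qed

lemma equiv_moore_equiv: "equiv (reachable M) (moore_equiv M)"
  by (rule equivI) (auto simp: moore_equiv_def refl_on_def sym_def trans_def)

lemma moore_equiv_out: "(p, q) \<in> moore_equiv M \<Longrightarrow> mout M p = mout M q"
  unfolding moore_equiv_def by (auto dest: spec[of _ "[]"])

lemma moore_equiv_step:
  assumes "(p, q) \<in> moore_equiv M"
  shows "(mtrans M p a, mtrans M q a) \<in> moore_equiv M"
proof -
  \<comment> \<open>A word \<open>v\<close> separating the successors would give the word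
    \<open>a # v\<close> separating \<open>p\<close> and \<open>q\<close>.\<close>
  have "mout M (mtrans_ext M p (a # v)) = mout M (mtrans_ext M q (a # v))" for v
    using assms unfolding moore_equiv_def by blast
  with assms show ?thesis by (auto simp: moore_equiv_def reachable_step)
qed

lemma minimize_class_out:
  assumes "q \<in> reachable M"
  shows "mout (minimize M) (moore_equiv M `` {q}) = mout M q"
proof -
  \<comment> \<open>\<open>the_elem\<close> yields the intended value only on a singleton: outputs
    agree on the class, and the class is nonempty since it contains \<open>q\<close>.\<close>
  have "mout M ` (moore_equiv M `` {q}) = {mout M q}"
    using equiv_class_self[OF equiv_moore_equiv assms] by (auto dest: moore_equiv_out)
  then show ?thesis by (simp add: minimize_def)
qed

lemma minimize_class_step:
  assumes "q \<in> reachable M"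
  shows "mtrans (minimize M) (moore_equiv M `` {q}) a = moore_equiv M `` {mtrans M q a}"
proof -
  have "moore_equiv M `` {mtrans M p a} = moore_equiv M `` {mtrans M q a}"
    if "p \<in> moore_equiv M `` {q}" for p
    using that equiv_class_eq[OF equiv_moore_equiv moore_equiv_step[of q p M a]] by simp
  then have "(\<lambda>p. moore_equiv M `` {mtrans M p a}) ` (moore_equiv M `` {q})
      = {moore_equiv M `` {mtrans M q a}}"
    using equiv_class_self[OF equiv_moore_equiv assms] by blast
  then show ?thesis by (simp add: minimize_def)
qed

text \<open>Stated for every reachable \<open>q\<close>, since the induction on \<open>u\<close>
  moves the starting state to a successor.\<close>

lemma minimize_class_run:
  assumes "q \<in> reachable M"
  shows "mout (minimize M) (mtrans_ext (minimize M) (moore_equiv M `` {q}) u)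
    = mout M (mtrans_ext M q u)"
  using assms
  by (induction u arbitrary: q)
    (simp_all add: minimize_class_out minimize_class_step reachable_step)

lemma minimize_output:
  "mout (minimize M) (mtrans_ext (minimize M) (minit (minimize M)) u)
    = mout M (mtrans_ext M (minit M) u)"
  using minimize_class_run[OF init_reachable, of M u] by (simp add: minimize_def)

lemma product_moore_run:
  "mtrans_ext (product_moore D D') (p, q) u = (foldl (dtrans D) p u, foldl (dtrans D') q u)"
  by (induction u arbitrary: p q) (simp_all add: product_moore_def)

theorem theorem4:
  fixes I :: "('a :: finite) rel"
    and \<phi> :: "'a ltrl"
    and A :: "('p, 'a) nondet_aut"
    and A' :: "('q, 'a) nondet_aut"
  assumes "trace_alphabet I"
    and "nondet_automaton A" and "nba_lang A = {w. models (trace_of I w) \<phi>}"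
    and "nondet_automaton A'" and "nba_lang A' = {w. models (trace_of I w) (Neg \<phi>)}"
  shows "\<forall>u :: 'a list. verdict_of I u \<phi> =
    mout (monitor A A') (mtrans_ext (monitor A A') (minit (monitor A A')) u)"
proof
  fix u :: "'a list"
  define D where "D = powerset_dfa (nonempty_nfa A)"
  define D' where "D' = powerset_dfa (nonempty_nfa A')"
  have "mout (monitor A A') (mtrans_ext (monitor A A') (minit (monitor A A')) u) =
      mout (product_moore D D')
        (mtrans_ext (product_moore D D') (minit (product_moore D D')) u)"
    by (simp add: monitor_def minimize_output D_def D'_def)
  also have "minit (product_moore D D') = (dinit D, dinit D')"
    by (simp add: product_moore_def)
  also have "mout (product_moore D D') (mtrans_ext (product_moore D D') (dinit D, dinit D') u) =
      (if foldl (dtrans D') (dinit D') u \<notin> dfinal D' then Top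
       else if foldl (dtrans D) (dinit D) u \<notin> dfinal D then Bot else Unknown)"
    unfolding product_moore_run by (simp add: product_moore_def)
  \<comment> \<open>Rejection by \<open>D'\<close> says that no extension of \<open>u\<close>
    satisfies \<open>Neg \<phi>\<close>, hence all satisfy \<phi>; rejection by \<open>D\<close>
    says that none satisfies \<phi>. The cases then match those of \<open>verdict_of\<close> in
    order.\<close>
  also have "\<dots> = verdict_of I u \<phi>"
    unfolding D_def D'_def extension_iff_dfa_accepts[OF assms(2)]
      extension_iff_dfa_accepts[OF assms(4)] assms(3,5)
    by (simp add: verdict_of_def models_def)
  finally show "verdict_of I u \<phi> =
    mout (monitor A A') (mtrans_ext (monitor A A') (minit (monitor A A')) u)" ..
qed

end
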